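(* (I) Let $Y_1,\dots,Y_n$ be jointly distributed (not necessarily independent) nonnegative random variables, let $X_1,\dots,X_n$ be independent random variables such that each $X_i$ has the same distribution as $Y_i$, and let $P$ be a Poisson random variable with parameter $1$ independent of $Y_1,\dots,Y_n$. Then $$\sum_{i=1}^n X_i\le_{cx} P\sum_{i=1}^n Y_i .$$ (II) For every nonnegative function $\varphi$ with finite expectation $\mathbb{E}[\varphi(P)]$ and every $\varepsilon>0$, there exist $n$ and random variables $X_1,\dots,X_n$, $Y_1,\dots,Y_n$ as in part (I) such that $$\mathbb{E}\Big[\varphi\Big(\sum_{i=1}^n X_i\Big)\Big]\ge (1-\varepsilon)\,\mathbb{E}\Big[\varphi\Big(P\sum_{i=1}^n Y_i\Big)\Big].$$
   Context: For random variables $X,Y$, we write $X\le_{cx}Y$ ($X$ is less than $Y$ in the convex order) if $\mathbb{E}\varphi(X)\le\mathbb{E}\varphi(Y)$ for every convex function $\varphi:\mathbb{R}\to\mathbb{R}$ for which both expectations exist. *)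

theory Defs
  imports "HOL-Probability.Probability"
begin

definition convex_order_le ::
  "'a measure \<Rightarrow> ('a \<Rightarrow> real) \<Rightarrow> 'b measure \<Rightarrow> ('b \<Rightarrow> real) \<Rightarrow> bool" where
  "convex_order_le M X N Y \<longleftrightarrow>
     (\<forall>\<phi> :: real \<Rightarrow> real. convex_on UNIV \<phi> \<longrightarrow>
        integrable M (\<lambda>\<omega>. \<phi> (X \<omega>)) \<longrightarrow> integrable N (\<lambda>\<omega>. \<phi> (Y \<omega>)) \<longrightarrow>
        (\<integral>\<omega>. \<phi> (X \<omega>) \<partial>M) \<le> (\<integral>\<omega>. \<phi> (Y \<omega>) \<partial>N))"

definition thm5_setting ::
  "nat \<Rightarrow> 'a measure \<Rightarrow> (nat \<Rightarrow> 'a \<Rightarrow> real) \<Rightarrow> ('a \<Rightarrow> nat) \<Rightarrow>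
   'b measure \<Rightarrow> (nat \<Rightarrow> 'b \<Rightarrow> real) \<Rightarrow> bool" where
  "thm5_setting n M Y P N X \<longleftrightarrow>
     prob_space M \<and> prob_space N \<and>
     (\<forall>i<n. Y i \<in> borel_measurable M) \<and>
     (\<forall>i<n. \<forall>\<omega>\<in>space M. 0 \<le> Y i \<omega>) \<and>
     (\<forall>i<n. X i \<in> borel_measurable N) \<and>
     prob_space.indep_vars N (\<lambda>_. borel) X {..<n} \<and>
     (\<forall>i<n. distr N borel (X i) = distr M borel (Y i)) \<and>
     P \<in> measurable M (count_space UNIV) \<and>
     distr M (count_space UNIV) P = measure_pmf (poisson_pmf 1) \<and>
     prob_space.indep_set M
        (sigma_sets (space M) {P -` A \<inter> space M | A. A \<in> sets (count_space UNIV)})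
        (sigma_sets (space M) {(\<lambda>\<omega>. restrict (\<lambda>i. Y i \<omega>) {..<n}) -` A \<inter> space M
            | A. A \<in> sets (PiM {..<n} (\<lambda>_. borel))})"

end

theory Submission
  imports Defs
begin

text \<open>
  Part (I). Write \<open>C(V)\<close> for the sum of a Poisson(1) number of independent copies of \<open>V\<close>. For nonnegative,
  arbitrarily dependent \<open>Y\<close>, \<open>Z\<close> and convex \<open>F\<close>, superadditivity of increments gives, conditionally on
  \<open>k\<close> copies,
  \<open>E F(\<Sum>(Y\<^sub>j + Z\<^sub>j)) - E F(\<Sum>Z\<^sub>j) \<ge> k (E F(\<Sum>\<^sub>j\<^sub><\<^sub>k Z\<^sub>j + Y) - E F(\<Sum>\<^sub>j\<^sub><\<^sub>k Z\<^sub>j))\<close> with \<open>Y\<close>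
  independent of the sum on the right. Averaging with \<open>k p\<^sub>k = p\<^sub>k\<^sub>-\<^sub>1\<close> turns the right-hand side into
  \<open>E F(C(Z) + Y) - E F(C(Z))\<close>, so \<open>E F(C(Y + Z)) \<ge> E F(C(Z) + Y)\<close> with \<open>Y\<close> now independent. Splitting off
  one summand at a time yields \<open>E F(\<Sum>X\<^sub>i) \<le> E F(C(\<Sum>Y\<^sub>i))\<close>, and replacing the independent copies by
  comonotone ones bounds this by \<open>E F(P \<Sum>Y\<^sub>i)\<close>. Everything is done for functions with values in
  \<open>[0, \<infinity>]\<close>; a general convex function is truncated from below.

  Part (II). Take \<open>X\<^sub>i\<close> Bernoulli(\<open>1/n\<close>) and let exactly one of the \<open>Y\<^sub>i\<close>, chosen uniformly, equal 1. Then
  \<open>P \<Sum>Y\<^sub>i = P\<close>, while \<open>\<Sum>X\<^sub>i\<close> is binomial and converges to Poisson(1); Fatou's lemma concludes.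
\<close>

section \<open>Convex functions of sums of nonnegative random variables\<close>

text \<open>Independence is encoded by iteration: \<open>(shift_mean M V ^^ k) F x\<close> is the
  mean of \<open>F\<close> at \<open>x\<close> plus \<open>k\<close> independent copies of
  \<open>V\<close>.\<close>

definition shift_mean :: "'a measure \<Rightarrow> ('a \<Rightarrow> real) \<Rightarrow> (real \<Rightarrow> ennreal) \<Rightarrow> real \<Rightarrow> ennreal" where
  "shift_mean M V F x = (\<integral>\<^sup>+\<omega>. F (x + V \<omega>) \<partial>M)"

text \<open>Stated without subtraction because \<open>F\<close> may take the value \<open>\<infinity>\<close>.\<close>
definition incr_convex :: "(real \<Rightarrow> ennreal) \<Rightarrow> bool" where
  "incr_convex F \<longleftrightarrow> F \<in> borel_measurable borel \<and>
     (\<forall>x a b. 0 \<le> a \<longrightarrow> 0 \<le> b \<longrightarrow> F (x + a) + F (x + b) \<le> F x + F (x + a + b))"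

lemma incr_convex_measurable: "incr_convex F \<Longrightarrow> F \<in> borel_measurable borel"
  by (simp add: incr_convex_def)

lemma incr_convexD:
  "incr_convex F \<Longrightarrow> 0 \<le> a \<Longrightarrow> 0 \<le> b \<Longrightarrow> F (x + a) + F (x + b) \<le> F x + F (x + a + b)"
  by (simp add: incr_convex_def)

text \<open>\<open>F\<close> need not be monotone, so an intermediate value is bounded by the two
  outer ones together; the finiteness arguments below rest on this.\<close>

lemma incr_convex_le:
  assumes "incr_convex F" "0 \<le> a" "0 \<le> b"
  shows "F (x + a) \<le> F x + F (x + a + b)"
proof -
  have "F (x + a) \<le> F (x + a) + F (x + b)"
    by simp
  also have "\<dots> \<le> F x + F (x + a + b)"
    using assms by (rule incr_convexD)
  finally show ?thesis .
qed

context prob_space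
begin

section \<open>Shift operators: measurability, commutation, preservation of
  \<open>incr_convex\<close>\<close>

lemma measurable_shift_mean:
  assumes [measurable]: "F \<in> borel_measurable borel" "V \<in> borel_measurable M"
  shows "shift_mean M V F \<in> borel_measurable borel"
  unfolding shift_mean_def by measurable

lemma measurable_shift_mean_funpow:
  assumes "F \<in> borel_measurable borel" "V \<in> borel_measurable M"
  shows "(shift_mean M V ^^ k) F \<in> borel_measurable borel"
  by (induction k) (simp_all add: assms measurable_shift_mean)

lemma shift_mean_commute:
  assumes [measurable]: "F \<in> borel_measurable borel" "V \<in> borel_measurable M" "W \<in> borel_measurable M"
  shows "shift_mean M V (shift_mean M W F) = shift_mean M W (shift_mean M V F)"
proof
  fix x
  interpret MM: pair_sigma_finite M M ..
  have "(\<integral>\<^sup>+\<omega>. \<integral>\<^sup>+\<eta>. F (x + V \<omega> + W \<eta>) \<partial>M \<partial>M) = (\<integral>\<^sup>+\<eta>. \<integral>\<^sup>+\<omega>. F (x + V \<omega> + W \<eta>) \<partial>M \<partial>M)"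
    by (rule MM.Fubini'[symmetric]) measurable
  then show "shift_mean M V (shift_mean M W F) x = shift_mean M W (shift_mean M V F) x"
    by (simp add: shift_mean_def add.assoc add.commute[of "W _"])
qed

lemma shift_mean_funpow_commute:
  assumes "F \<in> borel_measurable borel" "V \<in> borel_measurable M" "W \<in> borel_measurable M"
  shows "(shift_mean M V ^^ k) (shift_mean M W F) = shift_mean M W ((shift_mean M V ^^ k) F)"
  by (induction k)
    (simp_all add: assms shift_mean_commute measurable_shift_mean measurable_shift_mean_funpow)

lemma nn_integral_const_add:
  assumes "f \<in> borel_measurable M"
  shows "(\<integral>\<^sup>+\<omega>. c + f \<omega> \<partial>M) = c + (\<integral>\<^sup>+\<omega>. f \<omega> \<partial>M)"
  using assms by (simp add: nn_integral_add emeasure_space_1)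

lemma incr_convex_shift_mean:
  assumes F: "incr_convex F" and [measurable]: "V \<in> borel_measurable M"
  shows "incr_convex (shift_mean M V F)"
proof -
  note [measurable] = incr_convex_measurable[OF F]
  have "shift_mean M V F (x + a) + shift_mean M V F (x + b)
      \<le> shift_mean M V F x + shift_mean M V F (x + a + b)" if "0 \<le> a" "0 \<le> b" for x a b
  proof -
    have "(\<integral>\<^sup>+\<omega>. F (x + a + V \<omega>) + F (x + b + V \<omega>) \<partial>M)
        \<le> (\<integral>\<^sup>+\<omega>. F (x + V \<omega>) + F (x + a + b + V \<omega>) \<partial>M)"
    proof (rule nn_integral_mono)
      fix \<omega>
      show "F (x + a + V \<omega>) + F (x + b + V \<omega>) \<le> F (x + V \<omega>) + F (x + a + b + V \<omega>)"
        using incr_convexD[OF F that, of "x + V \<omega>"] by (simp add: algebra_simps)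
    qed
    then show ?thesis
      by (simp add: shift_mean_def nn_integral_add)
  qed
  then show ?thesis
    by (simp add: incr_convex_def measurable_shift_mean)
qed

lemma incr_convex_shift_mean_funpow:
  assumes "incr_convex F" "V \<in> borel_measurable M"
  shows "incr_convex ((shift_mean M V ^^ k) F)"
  by (induction k) (simp_all add: assms incr_convex_shift_mean)

section \<open>Increment inequalities for a single shift\<close>

text \<open>Increments of a convex function grow with the base point, so the mean increment
  \<open>E F(x + V) - F x\<close> is nondecreasing in \<open>x\<close>.\<close>

lemma shift_mean_diff_mono:
  assumes F: "incr_convex F" and [measurable]: "V \<in> borel_measurable M"
    and V: "\<And>\<omega>. \<omega> \<in> space M \<Longrightarrow> 0 \<le> V \<omega>" and a: "0 \<le> a"
  shows "F (x + a) + shift_mean M V F x \<le> F x + shift_mean M V F (x + a)"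
proof -
  note [measurable] = incr_convex_measurable[OF F]
  have "(\<integral>\<^sup>+\<omega>. F (x + a) + F (x + V \<omega>) \<partial>M) \<le> (\<integral>\<^sup>+\<omega>. F x + F (x + a + V \<omega>) \<partial>M)"
    using incr_convexD[OF F a V] by (rule nn_integral_mono)
  then show ?thesis
    by (simp add: shift_mean_def nn_integral_const_add)
qed

text \<open>The defining inequality is applied pointwise with increments \<open>Y \<omega>\<close>
  and \<open>Z \<omega>\<close>, so their joint law is arbitrary.\<close>

lemma shift_mean_superadditive:
  assumes F: "incr_convex F"
    and [measurable]: "Y \<in> borel_measurable M" "Z \<in> borel_measurable M"
    and nn: "\<And>\<omega>. \<omega> \<in> space M \<Longrightarrow> 0 \<le> Y \<omega>" "\<And>\<omega>. \<omega> \<in> space M \<Longrightarrow> 0 \<le> Z \<omega>"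
  shows "shift_mean M Y F x + shift_mean M Z F x \<le> F x + shift_mean M (\<lambda>\<omega>. Y \<omega> + Z \<omega>) F x"
proof -
  note [measurable] = incr_convex_measurable[OF F]
  have "(\<integral>\<^sup>+\<omega>. F (x + Y \<omega>) + F (x + Z \<omega>) \<partial>M) \<le> (\<integral>\<^sup>+\<omega>. F x + F (x + Y \<omega> + Z \<omega>) \<partial>M)"
    using incr_convexD[OF F nn] by (rule nn_integral_mono)
  then show ?thesis
    by (simp add: shift_mean_def nn_integral_add emeasure_space_1 add.assoc)
qed

text \<open>For each \<open>\<omega>\<close>, \<open>shift_mean_diff_mono\<close> compares the
  increment by an independent copy of \<open>Y\<close> at \<open>x + Z \<omega>\<close> and at
  \<open>x + Z \<omega> + Y \<omega>\<close>; integration keeps the joint law of \<open>Y\<close>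
  and \<open>Z\<close>.\<close>

lemma shift_mean_mixed_difference:
  assumes F: "incr_convex F"
    and [measurable]: "Y \<in> borel_measurable M" "Z \<in> borel_measurable M"
    and nn: "\<And>\<omega>. \<omega> \<in> space M \<Longrightarrow> 0 \<le> Y \<omega>"
  shows "shift_mean M (\<lambda>\<omega>. Y \<omega> + Z \<omega>) F x + shift_mean M Y (shift_mean M Z F) x
       \<le> shift_mean M Z F x + shift_mean M (\<lambda>\<omega>. Y \<omega> + Z \<omega>) (shift_mean M Y F) x"
proof -
  note [measurable] = incr_convex_measurable[OF F] measurable_shift_mean[OF incr_convex_measurable[OF F]]
  have "(\<integral>\<^sup>+\<omega>. F (x + Z \<omega> + Y \<omega>) + shift_mean M Y F (x + Z \<omega>) \<partial>M)
      \<le> (\<integral>\<^sup>+\<omega>. F (x + Z \<omega>) + shift_mean M Y F (x + Z \<omega> + Y \<omega>) \<partial>M)"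
    by (intro nn_integral_mono shift_mean_diff_mono F nn) auto
  then have "(\<integral>\<^sup>+\<omega>. F (x + Z \<omega> + Y \<omega>) \<partial>M) + shift_mean M Z (shift_mean M Y F) x
      \<le> shift_mean M Z F x + (\<integral>\<^sup>+\<omega>. shift_mean M Y F (x + Z \<omega> + Y \<omega>) \<partial>M)"
    by (subst (asm) (1 2) nn_integral_add) (simp_all add: shift_mean_def)
  moreover have "x + Z \<omega> + Y \<omega> = x + (Y \<omega> + Z \<omega>)" for \<omega>
    by simp
  ultimately show ?thesis
    by (simp add: shift_mean_def[of M "\<lambda>\<omega>. Y \<omega> + Z \<omega>"] shift_mean_commute[of F Y Z])
qed

section \<open>Iterated shifts: splitting one summand off, and comonotone copies\<close>

text \<open>An a priori bound for finiteness: if \<open>F x\<close> and an iterate with steps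
  \<open>Y + Z\<close> are finite, so is the iterate with steps \<open>Z\<close>. The slack
  \<open>t\<close> closes the induction by absorbing every \<open>Y\<close> and every surplus
  step.\<close>

lemma shift_mean_funpow_le:
  assumes F: "incr_convex F"
    and [measurable]: "Y \<in> borel_measurable M" "Z \<in> borel_measurable M"
    and nn: "\<And>\<omega>. \<omega> \<in> space M \<Longrightarrow> 0 \<le> Y \<omega>" "\<And>\<omega>. \<omega> \<in> space M \<Longrightarrow> 0 \<le> Z \<omega>"
    and "0 \<le> s" "0 \<le> t"
  shows "(shift_mean M Z ^^ j) F (x + s)
       \<le> F x + (shift_mean M (\<lambda>\<omega>. Y \<omega> + Z \<omega>) ^^ (j + l)) F (x + s + t)"
  using \<open>0 \<le> s\<close> \<open>0 \<le> t\<close>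
proof (induction j arbitrary: s t)
  let ?U = "shift_mean M (\<lambda>\<omega>. Y \<omega> + Z \<omega>)"
  note [measurable] = incr_convex_measurable[OF F] measurable_shift_mean_funpow[OF incr_convex_measurable[OF F]]
  {
    case 0
    then show ?case
    proof (induction l arbitrary: t)
      case 0
      then show ?case
        using incr_convex_le[OF F] by simp
    next
      case (Suc l)
      have "F (x + s) = (\<integral>\<^sup>+\<omega>. F (x + s) \<partial>M)"
        by (simp add: emeasure_space_1)
      also have "\<dots> \<le> (\<integral>\<^sup>+\<omega>. F x + (?U ^^ l) F (x + s + t + (Y \<omega> + Z \<omega>)) \<partial>M)"
        using Suc.IH[of "t + (Y _ + Z _)"] Suc.prems nn
        by (intro nn_integral_mono) (simp add: add.assoc)
      also have "\<dots> = F x + (?U ^^ Suc l) F (x + s + t)"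
        by (subst nn_integral_const_add) (simp_all add: shift_mean_def[of M "\<lambda>\<omega>. Y \<omega> + Z \<omega>" "(?U ^^ l) F"])
      finally show ?case
        by simp
    qed
  next
    case (Suc j)
    have "(shift_mean M Z ^^ Suc j) F (x + s) = (\<integral>\<^sup>+\<omega>. (shift_mean M Z ^^ j) F (x + (s + Z \<omega>)) \<partial>M)"
      by (simp add: shift_mean_def[of M Z "(shift_mean M Z ^^ j) F"] add.assoc)
    \<comment> \<open>One \<open>\<omega>\<close> serves both sides: \<open>Z \<omega>\<close> joins
      \<open>s\<close> and \<open>Y \<omega>\<close> joins \<open>t\<close>, which together make one
      step of \<open>?U\<close>.\<close>
    also have "\<dots> \<le> (\<integral>\<^sup>+\<omega>. F x + (?U ^^ (j + l)) F (x + (s + Z \<omega>) + (t + Y \<omega>)) \<partial>M)"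
      using Suc.prems nn by (intro nn_integral_mono Suc.IH) auto
    also have "\<dots> = F x + (?U ^^ (Suc j + l)) F (x + s + t)"
      by (subst nn_integral_const_add)
        (simp_all add: shift_mean_def[of M "\<lambda>\<omega>. Y \<omega> + Z \<omega>" "(?U ^^ (j + l)) F"] algebra_simps)
    finally show ?case .
  }
qed

text \<open>Over the reals this is the first inequality plus the second plus \<open>k\<close> times
  the third, with \<open>ub\<close>, \<open>k * ua\<close> and \<open>k * ug\<close> cancelled. If
  \<open>u\<close> and \<open>g\<close> are finite, finiteness spreads through the hypotheses to all
  other terms, which justifies cancelling.\<close>

lemma ennreal_step_combine:
  fixes b2 ab u g ub ua ug :: ennreal and k :: nat
  assumes "ub + of_nat k * ua \<le> u + of_nat k * ug" "b2 + ab \<le> g + ub" "ug + ab \<le> g + ua"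
    and "ug < \<top>" "0 < k"
  shows "b2 + of_nat (Suc k) * ab \<le> u + of_nat (Suc k) * g"
proof (cases "u = \<top> \<or> g = \<top>")
  case True
  then show ?thesis
    by (auto simp: ennreal_mult_top)
next
  case False
  have "of_nat k * ug < \<top>"
    using \<open>ug < \<top>\<close> by (simp add: ennreal_mult_less_top of_nat_less_top)
  then have "u + of_nat k * ug < \<top>"
    using False by (simp add: less_top)
  with assms(1) have "ub + of_nat k * ua < \<top>"
    by (rule le_less_trans)
  then have "ub < \<top>" "ua < \<top>"
    using \<open>0 < k\<close> by (auto simp: ennreal_mult_less_top)
  then have "g + ub < \<top>"
    using False by (simp add: less_top)
  with assms(2) have "b2 + ab < \<top>"
    by (rule le_less_trans)
  then have "b2 < \<top>" "ab < \<top>"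
    by auto
  obtain b2' where b2: "b2 = ennreal b2'" "0 \<le> b2'"
    using \<open>b2 < \<top>\<close> by (cases b2) auto
  obtain ab' where ab: "ab = ennreal ab'" "0 \<le> ab'"
    using \<open>ab < \<top>\<close> by (cases ab) auto
  obtain u' where u: "u = ennreal u'" "0 \<le> u'"
    using False by (cases u) auto
  obtain g' where g: "g = ennreal g'" "0 \<le> g'"
    using False by (cases g) auto
  obtain ub' where ub: "ub = ennreal ub'" "0 \<le> ub'"
    using \<open>ub < \<top>\<close> by (cases ub) auto
  obtain ua' where ua: "ua = ennreal ua'" "0 \<le> ua'"
    using \<open>ua < \<top>\<close> by (cases ua) auto
  obtain ug' where ug: "ug = ennreal ug'" "0 \<le> ug'"
    using \<open>ug < \<top>\<close> by (cases ug) auto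
  note eqs = b2(1) ab(1) u(1) g(1) ub(1) ua(1) ug(1)
  note nn = b2(2) ab(2) u(2) g(2) ub(2) ua(2) ug(2)
  have 1: "ub' + real k * ua' \<le> u' + real k * ug'" and 2: "b2' + ab' \<le> g' + ub'"
    and 3: "ug' + ab' \<le> g' + ua'"
    using assms(1-3) nn unfolding eqs
    by (simp_all add: ennreal_of_nat_eq_real_of_nat flip: ennreal_plus ennreal_mult)
  have "real k * (ug' + ab') \<le> real k * (g' + ua')"
    using 3 by (intro mult_left_mono) auto
  with 1 2 have "b2' + real (Suc k) * ab' \<le> u' + real (Suc k) * g'"
    by (simp add: algebra_simps)
  then show ?thesis
    using nn unfolding eqs
    by (simp add: ennreal_of_nat_eq_real_of_nat flip: ennreal_plus ennreal_mult del: of_nat_Suc)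
qed

text \<open>The inequality conditional on \<open>k\<close> copies, by induction: condition on one
  joint pair, use the hypothesis at the shifted point, then trade the pair for separate shifts by
  the two one-step inequalities. At \<open>k = 0\<close> the factor \<open>of_nat k\<close> hides
  the truncated \<open>k - 1\<close>.\<close>

lemma shift_mean_funpow_separate:
  assumes F: "incr_convex F"
    and [measurable]: "Y \<in> borel_measurable M" "Z \<in> borel_measurable M"
    and nn: "\<And>\<omega>. \<omega> \<in> space M \<Longrightarrow> 0 \<le> Y \<omega>" "\<And>\<omega>. \<omega> \<in> space M \<Longrightarrow> 0 \<le> Z \<omega>"
    and fin: "F x < \<top>"
  shows "(shift_mean M Z ^^ k) F x + of_nat k * (shift_mean M Z ^^ (k - 1)) (shift_mean M Y F) x
       \<le> (shift_mean M (\<lambda>\<omega>. Y \<omega> + Z \<omega>) ^^ k) F x + of_nat k * (shift_mean M Z ^^ (k - 1)) F x"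
  using fin
proof (induction k arbitrary: x)
  case 0
  then show ?case
    by simp
next
  case (Suc k)
  let ?A = "shift_mean M Y" and ?B = "shift_mean M Z" and ?U = "shift_mean M (\<lambda>\<omega>. Y \<omega> + Z \<omega>)"
  have le: "(?B ^^ j) F (x + s) \<le> F x + (?U ^^ (j + l)) F (x + s)" if "0 \<le> s" for s j x l
    using shift_mean_funpow_le[OF F assms(2,3) nn that order.refl] by simp
  show ?case
  proof (cases k)
    case 0
    then show ?thesis
      using shift_mean_superadditive[OF F, of Y Z x] nn by (simp add: add.commute)
  next
    case (Suc j)
    define G where "G = (?B ^^ j) F"
    have G: "incr_convex G"
      unfolding G_def by (intro incr_convex_shift_mean_funpow F) simp
    note [measurable] = incr_convex_measurable[OF F] incr_convex_measurable[OF G]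
      measurable_shift_mean measurable_shift_mean_funpow
    have BA: "(?B ^^ j) (?A F) = ?A G" "(?B ^^ k) (?A F) = ?A (?B G)" and B: "(?B ^^ k) F = ?B G"
      by (simp_all add: G_def Suc shift_mean_funpow_commute shift_mean_commute)
    show ?thesis
    proof (cases "(?U ^^ Suc k) F x = \<top>")
      case True
      then show ?thesis
        by (simp add: Suc)
    next
      case False
      have "(\<integral>\<^sup>+\<omega>. F (x + (Y \<omega> + Z \<omega>)) \<partial>M) \<le> (\<integral>\<^sup>+\<omega>. F x + (?U ^^ k) F (x + (Y \<omega> + Z \<omega>)) \<partial>M)"
        using le[of _ 0 _ k] nn by (intro nn_integral_mono) simp
      also have "\<dots> = F x + (?U ^^ Suc k) F x"
        by (subst nn_integral_const_add) (simp_all add: shift_mean_def[of M "\<lambda>\<omega>. Y \<omega> + Z \<omega>" "(?U ^^ k) F"])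
      also have "\<dots> < \<top>"
        using False Suc.prems by (simp add: less_top)
      \<comment> \<open>so the induction hypothesis applies at almost every shifted point\<close>
      finally have ae: "AE \<omega> in M. F (x + (Y \<omega> + Z \<omega>)) < \<top>"
        using nn_integral_PInf_AE[of "\<lambda>\<omega>. F (x + (Y \<omega> + Z \<omega>))" M] by (simp add: less_top)
      \<comment> \<open>Conditioning on the first joint pair: the induction hypothesis at
        \<open>x + (Y \<omega> + Z \<omega>)\<close> is integrated.\<close>
      have "(\<integral>\<^sup>+\<omega>. ?B G (x + (Y \<omega> + Z \<omega>)) + of_nat k * ?A G (x + (Y \<omega> + Z \<omega>)) \<partial>M)
          \<le> (\<integral>\<^sup>+\<omega>. (?U ^^ k) F (x + (Y \<omega> + Z \<omega>)) + of_nat k * G (x + (Y \<omega> + Z \<omega>)) \<partial>M)"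
        using ae by (intro nn_integral_mono_AE, elim eventually_mono) (use Suc.IH BA B in \<open>simp add: Suc G_def\<close>)
      then have 1: "?U (?B G) x + of_nat k * ?U (?A G) x \<le> (?U ^^ Suc k) F x + of_nat k * ?U G x"
        by (simp add: nn_integral_add nn_integral_cmult shift_mean_def[of M "\<lambda>\<omega>. Y \<omega> + Z \<omega>"])
      have 2: "?B (?B G) x + ?A (?B G) x \<le> ?B G x + ?U (?B G) x"
        using shift_mean_superadditive[OF incr_convex_shift_mean[OF G], of Z Y Z x] nn by (simp add: add.commute)
      have 3: "?U G x + ?A (?B G) x \<le> ?B G x + ?U (?A G) x"
        by (intro shift_mean_mixed_difference G nn) auto
      \<comment> \<open>Since \<open>k = Suc j\<close>, one surplus step (\<open>l = 1\<close>)
        bounds the term \<open>ug\<close> to be cancelled by quantities known to be finite.\<close>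
      have "?U G x \<le> (\<integral>\<^sup>+\<omega>. F x + (?U ^^ k) F (x + (Y \<omega> + Z \<omega>)) \<partial>M)"
        unfolding shift_mean_def[of M "\<lambda>\<omega>. Y \<omega> + Z \<omega>" G] unfolding G_def
        using le[of _ j _ 1] nn by (intro nn_integral_mono) (simp add: Suc)
      also have "\<dots> = F x + (?U ^^ Suc k) F x"
        by (subst nn_integral_const_add) (simp_all add: shift_mean_def[of M "\<lambda>\<omega>. Y \<omega> + Z \<omega>" "(?U ^^ k) F"])
      also have "\<dots> < \<top>"
        using False Suc.prems by (simp add: less_top)
      finally have "?U G x < \<top>" .
      from ennreal_step_combine[OF 1 2 3 this] show ?thesis
        using BA B by (simp add: Suc)
    qed
  qed
qed

text \<open>Conditioning on one copy reduces the claim to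
  \<open>E F(x + V + k V') \<le> E F(x + (k + 1) V)\<close> with \<open>V'\<close> an independent
  copy of \<open>V\<close>; averaging with the two copies exchanged makes this a pointwise
  inequality.\<close>

lemma shift_mean_funpow_comonotone:
  assumes F: "incr_convex F" and [measurable]: "V \<in> borel_measurable M"
    and nn: "\<And>\<omega>. \<omega> \<in> space M \<Longrightarrow> 0 \<le> V \<omega>"
  shows "(shift_mean M V ^^ k) F x \<le> (\<integral>\<^sup>+\<omega>. F (x + real k * V \<omega>) \<partial>M)"
proof (induction k arbitrary: x)
  case 0
  then show ?case
    by (simp add: emeasure_space_1)
next
  case (Suc k)
  note [measurable] = incr_convex_measurable[OF F]
  interpret MM: pair_sigma_finite M M ..
  define I where "I = (\<integral>\<^sup>+\<omega>. \<integral>\<^sup>+\<eta>. F (x + V \<omega> + real k * V \<eta>) \<partial>M \<partial>M)"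
  define J where "J = (\<integral>\<^sup>+\<omega>. F (x + real (Suc k) * V \<omega>) \<partial>M)"
  have I': "I = (\<integral>\<^sup>+\<omega>. \<integral>\<^sup>+\<eta>. F (x + V \<eta> + real k * V \<omega>) \<partial>M \<partial>M)"
    unfolding I_def by (rule MM.Fubini') measurable
  \<comment> \<open>Both mixed points lie between the outer ones: the base is
    \<open>x + (k + 1) v\<close>, the increments are \<open>w - v\<close> and
    \<open>k (w - v)\<close>.\<close>
  have pw: "F (x + v + real k * w) + F (x + w + real k * v)
      \<le> F (x + real (Suc k) * v) + F (x + real (Suc k) * w)" if "v \<le> w" for v w
  proof -
    have eqs: "x + real (Suc k) * v + (w - v) = x + w + real k * v"
      "x + real (Suc k) * v + real k * (w - v) = x + v + real k * w"
      "x + w + real k * v + real k * (w - v) = x + real (Suc k) * w"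
      by (simp_all add: algebra_simps)
    have "F (x + w + real k * v) + F (x + v + real k * w)
        \<le> F (x + real (Suc k) * v) + F (x + real (Suc k) * w)"
      using incr_convexD[OF F, of "w - v" "real k * (w - v)" "x + real (Suc k) * v"] that
      unfolding eqs by (simp del: of_nat_Suc)
    then show ?thesis
      by (simp only: add.commute[of "F (x + w + real k * v)" "F (x + v + real k * w)"])
  qed
  have pw': "F (x + v + real k * w) + F (x + w + real k * v)
      \<le> F (x + real (Suc k) * v) + F (x + real (Suc k) * w)" for v w
    using pw[of v w] pw[of w v] by (cases "v \<le> w") (simp_all add: add.commute)
  have "I + I = (\<integral>\<^sup>+\<omega>. \<integral>\<^sup>+\<eta>. F (x + V \<omega> + real k * V \<eta>) + F (x + V \<eta> + real k * V \<omega>) \<partial>M \<partial>M)"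
    by (subst I', subst I_def) (simp add: nn_integral_add)
  also have "\<dots> \<le> (\<integral>\<^sup>+\<omega>. \<integral>\<^sup>+\<eta>. F (x + real (Suc k) * V \<omega>) + F (x + real (Suc k) * V \<eta>) \<partial>M \<partial>M)"
    by (intro nn_integral_mono pw')
  also have "\<dots> = J + J"
    by (simp add: nn_integral_add nn_integral_const_add emeasure_space_1 J_def del: of_nat_Suc)
  finally have "I \<le> J"
    by (metis add_strict_mono not_le)
  have "(shift_mean M V ^^ Suc k) F x = (\<integral>\<^sup>+\<omega>. (shift_mean M V ^^ k) F (x + V \<omega>) \<partial>M)"
    by (simp add: shift_mean_def[of M V "(shift_mean M V ^^ k) F"])
  also have "\<dots> \<le> I"
    unfolding I_def by (intro nn_integral_mono Suc.IH)
  finally show ?case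
    using \<open>I \<le> J\<close> by (simp add: J_def)
qed

end

section \<open>Compound Poisson sums\<close>

text \<open>The mean of \<open>F(x + C(V))\<close> for the compound Poisson sum \<open>C(V)\<close>,
  with the random number of copies integrated out.\<close>

definition cpoisson_mean :: "'a measure \<Rightarrow> ('a \<Rightarrow> real) \<Rightarrow> (real \<Rightarrow> ennreal) \<Rightarrow> real \<Rightarrow> ennreal" where
  "cpoisson_mean M V F x = (\<integral>\<^sup>+k. (shift_mean M V ^^ k) F x \<partial>measure_pmf (poisson_pmf 1))"

text \<open>Poisson(1) weights satisfy \<open>(k + 1) p(k + 1) = p(k)\<close>, so weighting by
  \<open>k\<close> shifts the index by one; the term at \<open>k = 0\<close>, where
  \<open>k - 1\<close> is truncated, vanishes.\<close>

lemma nn_integral_poisson_size_bias: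
  "(\<integral>\<^sup>+k. of_nat k * g (k - 1) \<partial>measure_pmf (poisson_pmf 1)) = (\<integral>\<^sup>+k. g k \<partial>measure_pmf (poisson_pmf 1))"
proof -
  let ?p = "\<lambda>k. ennreal (pmf (poisson_pmf 1) k)"
  have p: "?p (Suc k) * of_nat (Suc k) = ?p k" for k
    by (simp add: ennreal_of_nat_eq_real_of_nat field_simps flip: ennreal_mult del: of_nat_Suc)
  have "(\<lambda>k. ?p (Suc k) * (of_nat (Suc k) * g (Suc k - 1))) sums (\<Sum>k. ?p k * g k)"
    by (simp only: p diff_Suc_1 mult.assoc[symmetric]) (intro summable_sums summableI)
  from sums_unique[OF sums_Suc[OF this]] have "(\<Sum>k. ?p k * (of_nat k * g (k - 1))) = (\<Sum>k. ?p k * g k)"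
    by simp
  then show ?thesis
    by (simp add: nn_integral_measure_pmf nn_integral_count_space_nat)
qed

text \<open>Averaging \<open>shift_mean_funpow_separate\<close> over the Poisson count and removing
  the factors \<open>k\<close> by size biasing leaves \<open>cpoisson_mean M Z F x\<close> on both
  sides; it is cancelled after being shown finite.\<close>

lemma (in prob_space) cpoisson_mean_separate:
  assumes F: "incr_convex F"
    and [measurable]: "Y \<in> borel_measurable M" "Z \<in> borel_measurable M"
    and nn: "\<And>\<omega>. \<omega> \<in> space M \<Longrightarrow> 0 \<le> Y \<omega>" "\<And>\<omega>. \<omega> \<in> space M \<Longrightarrow> 0 \<le> Z \<omega>"
  shows "cpoisson_mean M Z (shift_mean M Y F) x \<le> cpoisson_mean M (\<lambda>\<omega>. Y \<omega> + Z \<omega>) F x"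
proof (cases "F x = \<top> \<or> cpoisson_mean M (\<lambda>\<omega>. Y \<omega> + Z \<omega>) F x = \<top>")
  case True
  \<comment> \<open>The count 0 has positive probability and contributes \<open>F x\<close>
    itself.\<close>
  moreover have "cpoisson_mean M (\<lambda>\<omega>. Y \<omega> + Z \<omega>) F x = \<top>" if "F x = \<top>"
  proof (rule ccontr)
    assume "cpoisson_mean M (\<lambda>\<omega>. Y \<omega> + Z \<omega>) F x \<noteq> \<top>"
    then have "AE k in measure_pmf (poisson_pmf 1). (shift_mean M (\<lambda>\<omega>. Y \<omega> + Z \<omega>) ^^ k) F x \<noteq> \<infinity>"
      unfolding cpoisson_mean_def by (intro nn_integral_PInf_AE) auto
    then have "(shift_mean M (\<lambda>\<omega>. Y \<omega> + Z \<omega>) ^^ 0) F x \<noteq> \<infinity>"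
      unfolding AE_measure_pmf_iff by (metis UNIV_I set_pmf_poisson zero_less_one)
    with that show False
      by simp
  qed
  ultimately show ?thesis
    by auto
next
  case False
  let ?A = "shift_mean M Y" and ?B = "shift_mean M Z" and ?U = "shift_mean M (\<lambda>\<omega>. Y \<omega> + Z \<omega>)"
    and ?p = "measure_pmf (poisson_pmf 1)"
  have "cpoisson_mean M Z F x \<le> (\<integral>\<^sup>+k. F x + (?U ^^ k) F x \<partial>?p)"
    unfolding cpoisson_mean_def
    using shift_mean_funpow_le[OF F assms(2,3) nn order.refl order.refl, where l = 0 and x = x]
    by (intro nn_integral_mono) simp
  also have "\<dots> = F x + cpoisson_mean M (\<lambda>\<omega>. Y \<omega> + Z \<omega>) F x"
    by (simp add: measure_pmf.nn_integral_const_add cpoisson_mean_def)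
  finally have fin: "cpoisson_mean M Z F x < \<top>"
    using False by (simp add: less_top le_less_trans)
  have "(\<integral>\<^sup>+k. (?B ^^ k) F x + of_nat k * (?B ^^ (k - 1)) (?A F) x \<partial>?p)
      \<le> (\<integral>\<^sup>+k. (?U ^^ k) F x + of_nat k * (?B ^^ (k - 1)) F x \<partial>?p)"
    using False by (intro nn_integral_mono shift_mean_funpow_separate F nn) (auto simp: less_top)
  then have "cpoisson_mean M Z F x + cpoisson_mean M Z (?A F) x
      \<le> cpoisson_mean M (\<lambda>\<omega>. Y \<omega> + Z \<omega>) F x + cpoisson_mean M Z F x"
    using nn_integral_poisson_size_bias[of "\<lambda>k. (?B ^^ k) F x"]
      nn_integral_poisson_size_bias[of "\<lambda>k. (?B ^^ k) (?A F) x"]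
    by (simp add: nn_integral_add cpoisson_mean_def)
  then show ?thesis
    using fin by (auto simp: add.commute[of _ "cpoisson_mean M Z F x"] ennreal_add_left_cancel_le)
qed

text \<open>Induction on \<open>n\<close> with \<open>F\<close> arbitrary: integrating out the
  independent \<open>X n\<close> replaces \<open>F\<close> by \<open>shift_mean M (Y n) F\<close>,
  the hypothesis applies to that function, and \<open>cpoisson_mean_separate\<close> merges
  \<open>Y n\<close> into the dependent sum.\<close>

lemma nn_integral_indep_sum_le_cpoisson:
  fixes X :: "nat \<Rightarrow> 'b \<Rightarrow> real" and Y :: "nat \<Rightarrow> 'a \<Rightarrow> real"
  assumes "prob_space M" "prob_space N"
    and Y: "\<And>i. i < n \<Longrightarrow> Y i \<in> borel_measurable M"
    and nn: "\<And>i \<omega>. i < n \<Longrightarrow> \<omega> \<in> space M \<Longrightarrow> 0 \<le> Y i \<omega>"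
    and X: "prob_space.indep_vars N (\<lambda>_. borel) X {..<n}"
    and XY: "\<And>i. i < n \<Longrightarrow> distr N borel (X i) = distr M borel (Y i)"
    and F: "incr_convex F"
  shows "(\<integral>\<^sup>+\<omega>. F (x + (\<Sum>i<n. X i \<omega>)) \<partial>N) \<le> cpoisson_mean M (\<lambda>\<omega>. \<Sum>i<n. Y i \<omega>) F x"
proof -
  interpret M: prob_space M by fact
  interpret N: prob_space N by fact
  show ?thesis
    using Y nn X XY F
  proof (induction n arbitrary: F)
    case 0
    have "(shift_mean M (\<lambda>\<omega>. 0) ^^ k) F x = F x" for k
      by (induction k arbitrary: x) (simp_all add: shift_mean_def M.emeasure_space_1)
    then show ?case
      by (simp add: cpoisson_mean_def N.emeasure_space_1)
  next
    case (Suc n)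
    note F = Suc.prems(5)
    note [measurable] = incr_convex_measurable[OF F]
    have ind: "N.indep_var borel (X n) borel (\<lambda>\<omega>. \<Sum>i<n. X i \<omega>)"
      using Suc.prems(3) by (intro N.indep_vars_sum) (auto simp: lessThan_Suc)
    then have [measurable]: "X n \<in> borel_measurable N" "(\<lambda>\<omega>. \<Sum>i<n. X i \<omega>) \<in> borel_measurable N"
      by (auto dest: N.indep_var_rv1 N.indep_var_rv2)
    have Yn[measurable]: "Y i \<in> borel_measurable M" if "i < Suc n" for i
      using Suc.prems(1) that .
    have [measurable]: "Y n \<in> borel_measurable M"
      by simp
    let ?D = "distr N borel (X n)" and ?E = "distr N borel (\<lambda>\<omega>. \<Sum>i<n. X i \<omega>)"
    interpret D: prob_space ?D
      by (intro N.prob_space_distr) simp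
    interpret E: prob_space ?E
      by (intro N.prob_space_distr) simp
    interpret ED: pair_sigma_finite ?D ?E ..
    have "(\<integral>\<^sup>+\<omega>. F (x + (\<Sum>i<Suc n. X i \<omega>)) \<partial>N)
        = (\<integral>\<^sup>+z. F (x + (snd z + fst z)) \<partial>distr N (borel \<Otimes>\<^sub>M borel) (\<lambda>\<omega>. (X n \<omega>, \<Sum>i<n. X i \<omega>)))"
      by (simp add: nn_integral_distr)
    also have "\<dots> = (\<integral>\<^sup>+z. F (x + (snd z + fst z)) \<partial>(?D \<Otimes>\<^sub>M ?E))"
      using ind by (simp add: N.indep_var_distribution_eq)
    also have "\<dots> = (\<integral>\<^sup>+s. \<integral>\<^sup>+y. F (x + (s + y)) \<partial>?D \<partial>?E)"
      by (subst ED.nn_integral_snd[symmetric]) simp_all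
    also have "\<dots> = (\<integral>\<^sup>+s. shift_mean M (Y n) F (x + s) \<partial>?E)"
      by (simp add: Suc.prems(4) nn_integral_distr shift_mean_def add.assoc)
    also have "\<dots> = (\<integral>\<^sup>+\<omega>. shift_mean M (Y n) F (x + (\<Sum>i<n. X i \<omega>)) \<partial>N)"
      using M.measurable_shift_mean[of F "Y n"] by (simp add: nn_integral_distr)
    also have "\<dots> \<le> cpoisson_mean M (\<lambda>\<omega>. \<Sum>i<n. Y i \<omega>) (shift_mean M (Y n) F) x"
      using Suc.prems N.indep_vars_subset[OF Suc.prems(3), of "{..<n}"]
      by (intro Suc.IH M.incr_convex_shift_mean F) auto
    also have "\<dots> \<le> cpoisson_mean M (\<lambda>\<omega>. Y n \<omega> + (\<Sum>i<n. Y i \<omega>)) F x"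
      using Suc.prems(2) by (intro M.cpoisson_mean_separate F) (auto intro!: sum_nonneg borel_measurable_sum)
    finally show ?case
      by (simp add: add.commute)
  qed
qed

text \<open>Preimages under a composition are preimages under the inner map, so the generators only
  shrink. The form with generated sigma-algebras is the one in \<open>thm5_setting\<close>.\<close>

lemma (in prob_space) indep_set_vimage_compose:
  assumes ind: "indep_set (sigma_sets (space M) {X -` A \<inter> space M | A. A \<in> sets S})
      (sigma_sets (space M) {Y -` A \<inter> space M | A. A \<in> sets T})"
    and X: "X \<in> space M \<rightarrow> space S" and Y: "Y \<in> space M \<rightarrow> space T"
    and f: "f \<in> measurable S S'" and g: "g \<in> measurable T T'"
  shows "indep_set (sigma_sets (space M) {(\<lambda>\<omega>. f (X \<omega>)) -` A \<inter> space M | A. A \<in> sets S'})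
      (sigma_sets (space M) {(\<lambda>\<omega>. g (Y \<omega>)) -` A \<inter> space M | A. A \<in> sets T'})"
proof -
  have *: "{(\<lambda>\<omega>. h (Z \<omega>)) -` A \<inter> space M | A. A \<in> sets Q'} \<subseteq> {Z -` A \<inter> space M | A. A \<in> sets Q}"
    if Z: "Z \<in> space M \<rightarrow> space Q" and h: "h \<in> measurable Q Q'"
    for Z :: "'a \<Rightarrow> 'q" and h :: "'q \<Rightarrow> 'r" and Q Q'
  proof clarify
    fix A assume "A \<in> sets Q'"
    then have "h -` A \<inter> space Q \<in> sets Q"
      using h by (rule measurable_sets[rotated])
    moreover have "(\<lambda>\<omega>. h (Z \<omega>)) -` A \<inter> space M = Z -` (h -` A \<inter> space Q) \<inter> space M"
      using Z by auto
    ultimately show "\<exists>B. (\<lambda>\<omega>. h (Z \<omega>)) -` A \<inter> space M = Z -` B \<inter> space M \<and> B \<in> sets Q"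
      by blast
  qed
  show ?thesis
    using ind unfolding indep_set_def
    by (rule indep_sets_mono_sets)
      (use *[OF X f] *[OF Y g] in \<open>auto split: bool.split intro: sigma_sets_mono' [THEN subsetD]\<close>)
qed

section \<open>The convex order bound\<close>

text \<open>\<open>x + a\<close> and \<open>x + b\<close> are convex combinations of
  \<open>x\<close> and \<open>x + a + b\<close> with interchanged weights; the two convexity
  inequalities are added.\<close>

lemma incr_convex_convex_on:
  fixes \<phi> :: "real \<Rightarrow> real"
  assumes \<phi>: "convex_on UNIV \<phi>" and nn: "\<And>x. 0 \<le> \<phi> x"
  shows "incr_convex (\<lambda>x. ennreal (\<phi> x))"
proof -
  have "\<phi> (x + a) + \<phi> (x + b) \<le> \<phi> x + \<phi> (x + a + b)" if "0 \<le> a" "0 \<le> b" for x a b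
  proof (cases "a + b = 0")
    case True
    with that have "a = 0" "b = 0"
      by auto
    then show ?thesis
      by simp
  next
    case False
    define t where "t = a / (a + b)"
    have t: "0 \<le> t" "t \<le> 1" "t * (a + b) = a"
      using that False by (auto simp: t_def)
    have "\<phi> (x + a) = \<phi> ((1 - t) *\<^sub>R x + t *\<^sub>R (x + a + b))"
      using t(3) by (intro arg_cong[where f = \<phi>]) (simp add: algebra_simps)
    also have "\<dots> \<le> (1 - t) * \<phi> x + t * \<phi> (x + a + b)"
      using t \<phi> by (intro convex_onD[of UNIV]) auto
    finally have 1: "\<phi> (x + a) \<le> (1 - t) * \<phi> x + t * \<phi> (x + a + b)" .
    have "\<phi> (x + b) = \<phi> ((1 - (1 - t)) *\<^sub>R x + (1 - t) *\<^sub>R (x + a + b))"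
      using t(3) by (intro arg_cong[where f = \<phi>]) (simp add: algebra_simps)
    also have "\<dots> \<le> (1 - (1 - t)) * \<phi> x + (1 - t) * \<phi> (x + a + b)"
      using t \<phi> by (intro convex_onD[of UNIV]) auto
    finally show ?thesis
      using 1 by (simp add: algebra_simps)
  qed
  moreover have "\<phi> \<in> borel_measurable borel"
    using convex_measurable[of "\<lambda>x. x" borel UNIV \<phi>] \<phi> by simp
  ultimately show ?thesis
    using nn by (simp add: incr_convex_def ennreal_leI flip: ennreal_plus)
qed

text \<open>The compound Poisson bound at 0 is followed by the comonotone bound for each count
  \<open>k\<close>; independence of \<open>P\<close> from the vector of the \<open>Y i\<close> turns
  the average over \<open>k\<close> into an expectation over \<open>M\<close>.\<close>

lemma thm5_setting_nn_integral_le: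
  fixes M :: "'a measure" and N :: "'b measure"
  assumes setting: "thm5_setting n M Y P N X" and F: "incr_convex F"
  shows "(\<integral>\<^sup>+\<omega>. F (\<Sum>i<n. X i \<omega>) \<partial>N) \<le> (\<integral>\<^sup>+\<omega>. F (real (P \<omega>) * (\<Sum>i<n. Y i \<omega>)) \<partial>M)"
proof -
  note [measurable] = incr_convex_measurable[OF F]
  interpret M: prob_space M
    using setting by (simp add: thm5_setting_def)
  interpret N: prob_space N
    using setting by (simp add: thm5_setting_def)
  have Y: "Y i \<in> borel_measurable M" if "i < n" for i
    using setting that by (simp add: thm5_setting_def)
  have P[measurable]: "P \<in> measurable M (count_space UNIV)"
    using setting by (simp add: thm5_setting_def)
  have S[measurable]: "(\<lambda>\<omega>. \<Sum>i<n. Y i \<omega>) \<in> borel_measurable M"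
    using Y by (intro borel_measurable_sum) simp
  have S0: "0 \<le> (\<Sum>i<n. Y i \<omega>)" if "\<omega> \<in> space M" for \<omega>
    using setting that by (auto simp: thm5_setting_def intro!: sum_nonneg)
  let ?S = "\<lambda>\<omega>. \<Sum>i<n. Y i \<omega>" and ?R = "\<lambda>\<omega>. restrict (\<lambda>i. Y i \<omega>) {..<n}"
  \<comment> \<open>The sum is written through the restricted vector \<open>?R\<close>, for which
    the setting states independence.\<close>
  have "M.indep_set (sigma_sets (space M) {(\<lambda>\<omega>. real (P \<omega>)) -` A \<inter> space M | A. A \<in> sets borel})
      (sigma_sets (space M) {(\<lambda>\<omega>. \<Sum>i<n. ?R \<omega> i) -` A \<inter> space M | A. A \<in> sets borel})"
    by (rule M.indep_set_vimage_compose[of P "count_space UNIV" ?R "PiM {..<n} (\<lambda>_. borel)"])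
      (use setting in \<open>simp_all add: thm5_setting_def space_PiM Pi_iff\<close>)
  then have ind: "M.indep_var borel (\<lambda>\<omega>. real (P \<omega>)) borel ?S"
    by (simp add: M.indep_var_eq)
  interpret D: prob_space "distr M borel ?S"
    by (intro M.prob_space_distr) simp
  have "(\<integral>\<^sup>+\<omega>. F (\<Sum>i<n. X i \<omega>) \<partial>N) \<le> cpoisson_mean M ?S F 0"
    using nn_integral_indep_sum_le_cpoisson[of M N n Y X F 0] setting F
    by (simp add: thm5_setting_def)
  also have "\<dots> \<le> (\<integral>\<^sup>+k. \<integral>\<^sup>+\<omega>. F (real k * ?S \<omega>) \<partial>M \<partial>measure_pmf (poisson_pmf 1))"
    unfolding cpoisson_mean_def
    using M.shift_mean_funpow_comonotone[OF F S S0, of _ 0] by (intro nn_integral_mono) simp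
  also have "\<dots> = (\<integral>\<^sup>+k. \<integral>\<^sup>+s. F (real k * s) \<partial>distr M borel ?S \<partial>distr M (count_space UNIV) P)"
    using setting unfolding thm5_setting_def by (subst nn_integral_distr) simp_all
  also have "\<dots> = (\<integral>\<^sup>+p. \<integral>\<^sup>+s. F (p * s) \<partial>distr M borel ?S \<partial>distr M borel (\<lambda>\<omega>. real (P \<omega>)))"
    by (simp add: nn_integral_distr)
  also have "\<dots> = (\<integral>\<^sup>+z. F (fst z * snd z) \<partial>(distr M borel (\<lambda>\<omega>. real (P \<omega>)) \<Otimes>\<^sub>M distr M borel ?S))"
    by (subst D.nn_integral_fst[symmetric]) simp_all
  also have "\<dots> = (\<integral>\<^sup>+z. F (fst z * snd z) \<partial>distr M (borel \<Otimes>\<^sub>M borel) (\<lambda>\<omega>. (real (P \<omega>), ?S \<omega>)))"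
    using ind by (simp add: M.indep_var_distribution_eq)
  also have "\<dots> = (\<integral>\<^sup>+\<omega>. F (real (P \<omega>) * ?S \<omega>) \<partial>M)"
    by (simp add: nn_integral_distr)
  finally show ?thesis .
qed

text \<open>\<open>max \<phi> (-K) + K\<close> is nonnegative and convex, so the bound for
  \<open>incr_convex\<close> functions applies; the constant \<open>K\<close> cancels under
  probability measures, and then \<open>K\<close> tends to infinity.\<close>

lemma thm5_setting_convex_order_le:
  fixes M :: "'a measure" and N :: "'b measure"
  assumes setting: "thm5_setting n M Y P N X"
  shows "convex_order_le N (\<lambda>\<omega>. \<Sum>i<n. X i \<omega>) M (\<lambda>\<omega>. real (P \<omega>) * (\<Sum>i<n. Y i \<omega>))"
  unfolding convex_order_le_def
proof (intro allI impI)
  fix \<phi> :: "real \<Rightarrow> real"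
  let ?S = "\<lambda>\<omega>. \<Sum>i<n. X i \<omega>" and ?T = "\<lambda>\<omega>. real (P \<omega>) * (\<Sum>i<n. Y i \<omega>)"
  assume \<phi>: "convex_on UNIV \<phi>"
    and iS: "integrable N (\<lambda>\<omega>. \<phi> (?S \<omega>))" and iT: "integrable M (\<lambda>\<omega>. \<phi> (?T \<omega>))"
  interpret M: prob_space M
    using setting by (simp add: thm5_setting_def)
  interpret N: prob_space N
    using setting by (simp add: thm5_setting_def)
  \<comment> \<open>Truncating at \<open>-K\<close> rather than subtracting a supporting line avoids any assumption on first moments.\<close>
  have trunc: "(\<integral>\<omega>. max (\<phi> (?S \<omega>)) (- real K) \<partial>N) \<le> (\<integral>\<omega>. max (\<phi> (?T \<omega>)) (- real K) \<partial>M)" for K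
  proof -
    let ?\<psi> = "\<lambda>x. max (\<phi> x) (- real K) + real K"
    have iS': "integrable N (\<lambda>\<omega>. max (\<phi> (?S \<omega>)) (- real K))"
      and iT': "integrable M (\<lambda>\<omega>. max (\<phi> (?T \<omega>)) (- real K))"
      using iS iT by (auto intro!: integrable_max)
    have "convex_on UNIV ?\<psi>"
    proof (rule convex_onI)
      fix t x y :: real
      assume t: "0 < t" "t < 1"
      have "\<phi> ((1 - t) *\<^sub>R x + t *\<^sub>R y) \<le> (1 - t) * \<phi> x + t * \<phi> y"
        using t \<phi> by (intro convex_onD[of UNIV]) auto
      also have "\<dots> \<le> (1 - t) * max (\<phi> x) (- real K) + t * max (\<phi> y) (- real K)"
        using t by (intro add_mono mult_left_mono) auto
      finally have 1: "\<phi> ((1 - t) *\<^sub>R x + t *\<^sub>R y) \<le> \<dots>" .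
      have "- real K = (1 - t) * (- real K) + t * (- real K)"
        by (simp add: algebra_simps)
      also have "\<dots> \<le> (1 - t) * max (\<phi> x) (- real K) + t * max (\<phi> y) (- real K)"
        using t by (intro add_mono mult_left_mono) auto
      finally have "max (\<phi> ((1 - t) *\<^sub>R x + t *\<^sub>R y)) (- real K)
          \<le> (1 - t) * max (\<phi> x) (- real K) + t * max (\<phi> y) (- real K)"
        using 1 by simp
      then show "?\<psi> ((1 - t) *\<^sub>R x + t *\<^sub>R y) \<le> (1 - t) * ?\<psi> x + t * ?\<psi> y"
        by (simp add: algebra_simps)
    qed simp
    then have "incr_convex (\<lambda>x. ennreal (?\<psi> x))"
      by (intro incr_convex_convex_on) auto
    from thm5_setting_nn_integral_le[OF setting this]
    have "ennreal (\<integral>\<omega>. ?\<psi> (?S \<omega>) \<partial>N) \<le> ennreal (\<integral>\<omega>. ?\<psi> (?T \<omega>) \<partial>M)"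
      using iS' iT' by (subst (asm) (1 2) nn_integral_eq_integral) auto
    moreover have "0 \<le> (\<integral>\<omega>. ?\<psi> (?T \<omega>) \<partial>M)"
      by (intro integral_nonneg_AE) auto
    ultimately have "(\<integral>\<omega>. ?\<psi> (?S \<omega>) \<partial>N) \<le> (\<integral>\<omega>. ?\<psi> (?T \<omega>) \<partial>M)"
      by (simp add: ennreal_le_iff)
    then show ?thesis
      using iS' iT' by (simp add: M.prob_space N.prob_space)
  qed
  \<comment> \<open>The truncations are dominated by \<open>\<bar>f\<bar>\<close> and at each point
    equal \<open>f\<close> once \<open>K\<close> reaches \<open>- f \<omega>\<close>.\<close>
  have lim: "(\<lambda>K. \<integral>\<omega>. max (f \<omega>) (- real K) \<partial>L) \<longlonglongrightarrow> (\<integral>\<omega>. f \<omega> \<partial>L)"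
    if f: "integrable L f" for L :: "'c measure" and f :: "'c \<Rightarrow> real"
  proof (rule integral_dominated_convergence[where w = "\<lambda>\<omega>. \<bar>f \<omega>\<bar>"])
    have "\<forall>\<^sub>F K in sequentially. max (f \<omega>) (- real K) = f \<omega>" for \<omega>
      using eventually_ge_at_top[of "nat \<lceil>- f \<omega>\<rceil>"] by eventually_elim linarith
    then show "AE \<omega> in L. (\<lambda>K. max (f \<omega>) (- real K)) \<longlonglongrightarrow> f \<omega>"
      by (intro AE_I2 tendsto_eventually)
  qed (use f in auto)
  show "(\<integral>\<omega>. \<phi> (?S \<omega>) \<partial>N) \<le> (\<integral>\<omega>. \<phi> (?T \<omega>) \<partial>M)"
    by (rule LIMSEQ_le[OF lim[OF iS] lim[OF iT]]) (use trunc in auto)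
qed

section \<open>Asymptotic sharpness\<close>

text \<open>Passing from \<open>k\<close> to \<open>k + 1\<close> multiplies the term by
  \<open>(1 - k / n) / (k + 1)\<close>, which tends to \<open>1 / (k + 1)\<close>.\<close>

lemma binomial_over_power_tendsto: "(\<lambda>n. real (n choose k) / real n ^ k) \<longlonglongrightarrow> 1 / fact k"
proof (induction k)
  case 0
  then show ?case
    by simp
next
  case (Suc k)
  have "(\<lambda>n. 1 - real k * (1 / real n)) \<longlonglongrightarrow> 1 - real k * 0"
    by (intro tendsto_intros lim_1_over_n)
  then have "(\<lambda>n. real (n choose k) / real n ^ k * (1 - real k * (1 / real n)) / real (Suc k))
      \<longlonglongrightarrow> 1 / fact k * (1 - real k * 0) / real (Suc k)"
    by (intro tendsto_intros Suc.IH) simp_all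
  moreover have "\<forall>\<^sub>F n in sequentially.
      real (n choose k) / real n ^ k * (1 - real k * (1 / real n)) / real (Suc k)
      = real (n choose Suc k) / real n ^ Suc k"
    using eventually_gt_at_top[of k]
  proof eventually_elim
    case (elim n)
    have "real (Suc k) * real (n choose Suc k) = real (n - k) * real (n choose k)"
      by (metis binomial_absorb_comp binomial_absorption of_nat_mult mult.commute)
    then have "real (n choose Suc k) = (real n - real k) * real (n choose k) / real (Suc k)"
      using elim by (simp add: field_simps of_nat_diff del: of_nat_Suc)
    then show ?case
      using elim by (simp only:) (simp add: field_simps del: of_nat_Suc)
  qed
  ultimately show ?case
    by (simp add: tendsto_cong mult.commute[of "fact k"])
qed

text \<open>The binomial weight is \<open>(n choose k) / n ^ k\<close> times
  \<open>(1 - 1/n) ^ n\<close> over \<open>(1 - 1/n) ^ k\<close>, with limits \<open>1 / k!\<close>,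
  \<open>exp (-1)\<close> and 1.\<close>

lemma pmf_binomial_tendsto_poisson:
  "(\<lambda>n. pmf (binomial_pmf n (1 / real n)) k) \<longlonglongrightarrow> pmf (poisson_pmf 1) k"
proof -
  have "(\<lambda>n. 1 - 1 / real n) \<longlonglongrightarrow> 1 - 0"
    by (intro tendsto_intros lim_1_over_n)
  then have "(\<lambda>n. real (n choose k) / real n ^ k * ((1 + (-1) / real n) ^ n / (1 - 1 / real n) ^ k))
      \<longlonglongrightarrow> 1 / fact k * (exp (-1) / (1 - 0) ^ k)"
    by (intro tendsto_intros tendsto_exp_limit_sequentially binomial_over_power_tendsto) simp_all
  moreover have "\<forall>\<^sub>F n in sequentially.
      real (n choose k) / real n ^ k * ((1 + (-1) / real n) ^ n / (1 - 1 / real n) ^ k)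
      = pmf (binomial_pmf n (1 / real n)) k"
    \<comment> \<open>Then \<open>1 - 1/n\<close> is nonzero and \<open>n - k\<close> is a true
      difference.\<close>
    using eventually_gt_at_top[of "max 1 k"]
    by eventually_elim (simp add: power_diff power_one_over field_simps)
  ultimately show ?thesis
    by (simp add: tendsto_cong)
qed

section \<open>The extremal example: Bernoulli summands against a uniformly placed unit\<close>

lemma distr_measure_pmf_cong:
  assumes "map_pmf f p = map_pmf g q" and "sets M = sets N" and "space M = UNIV"
  shows "distr (measure_pmf p) M f = distr (measure_pmf q) N g"
proof -
  have *: "distr (measure_pmf r) M h = distr (measure_pmf (map_pmf h r)) M (\<lambda>x. x)" for r :: "'r pmf" and h
    using assms(3) by (simp add: map_pmf_rep_eq distr_distr o_def)
  have "distr (measure_pmf p) M f = distr (measure_pmf q) M g"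
    unfolding *[of p f] *[of q g] assms(1) ..
  also have "\<dots> = distr (measure_pmf q) N g"
    using assms by (intro distr_cong) auto
  finally show ?thesis .
qed

lemma map_pmf_eq_uniform:
  assumes "i < n"
  shows "map_pmf (\<lambda>j. j = i) (pmf_of_set {..<n}) = bernoulli_pmf (1 / real n)"
proof (rule pmf_eqI)
  fix b
  have "pmf (map_pmf (\<lambda>j. j = i) (pmf_of_set {..<n})) True = 1 / real n"
    using assms by (subst pmf_map, subst measure_pmf_of_set) (auto simp: vimage_def Int_def cong: conj_cong)
  then show "pmf (map_pmf (\<lambda>j. j = i) (pmf_of_set {..<n})) b = pmf (bernoulli_pmf (1 / real n)) b"
    using assms by (cases b) (auto simp: pmf_False_conv_True)
qed

definition bernoulli_product :: "nat \<Rightarrow> (nat \<Rightarrow> real) pmf" where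
  "bernoulli_product n = Pi_pmf {..<n} 0 (\<lambda>_. map_pmf of_bool (bernoulli_pmf (1 / real n)))"

text \<open>Coordinate 0 carries the Poisson variable, coordinate 1 the uniformly chosen index of the single
  summand that equals 1.\<close>
definition poisson_uniform :: "nat \<Rightarrow> (nat \<Rightarrow> real) pmf" where
  "poisson_uniform n = Pi_pmf {0, 1} 0
     (\<lambda>i. if i = 0 then map_pmf real (poisson_pmf 1) else map_pmf real (pmf_of_set {..<n}))"

lemma poisson_uniform_fst: "map_pmf (\<lambda>\<omega>. \<omega> 0) (poisson_uniform n) = map_pmf real (poisson_pmf 1)"
  by (simp add: poisson_uniform_def Pi_pmf_component)

lemma poisson_uniform_snd: "map_pmf (\<lambda>\<omega>. \<omega> 1) (poisson_uniform n) = map_pmf real (pmf_of_set {..<n})"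
  by (simp add: poisson_uniform_def Pi_pmf_component)

text \<open>Coordinates are real-valued, so the count is read back by
  \<open>nat \<lfloor>\<omega> 0\<rfloor>\<close>. All \<open>Y i\<close> factor through coordinate
  1, hence the whole vector is independent of the count in coordinate 0.\<close>

lemma thm5_setting_bernoulli:
  assumes "0 < n"
  shows "thm5_setting n (measure_pmf (poisson_uniform n)) (\<lambda>i \<omega>. of_bool (\<omega> 1 = real i)) (\<lambda>\<omega>. nat \<lfloor>\<omega> 0\<rfloor>)
     (measure_pmf (bernoulli_product n)) (\<lambda>i \<omega>. \<omega> i)"
proof -
  let ?M = "poisson_uniform n" and ?N = "bernoulli_product n"
  let ?Y = "\<lambda>i \<omega>. of_bool (\<omega> (1::nat) = real i) :: real" and ?P = "\<lambda>\<omega>::nat \<Rightarrow> real. nat \<lfloor>\<omega> 0\<rfloor>"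
  have "prob_space.indep_vars ?N (\<lambda>_. count_space UNIV) (\<lambda>i \<omega>. \<omega> i) {..<n}"
    unfolding bernoulli_product_def by (rule indep_vars_Pi_pmf) simp
  then have indX: "prob_space.indep_vars ?N (\<lambda>_. borel) (\<lambda>i \<omega>. \<omega> i) {..<n}"
    by (rule prob_space.indep_vars_compose2[OF measure_pmf.prob_space_axioms, where Y = "\<lambda>_ x. x"]) simp
  have law: "distr ?N borel (\<lambda>\<omega>. \<omega> i) = distr ?M borel (?Y i)" if "i < n" for i
  proof (rule distr_measure_pmf_cong)
    have "map_pmf (?Y i) ?M = map_pmf (\<lambda>x. of_bool (x = real i)) (map_pmf (\<lambda>\<omega>. \<omega> 1) ?M)"
      by (simp add: map_pmf_comp)
    also have "\<dots> = map_pmf of_bool (map_pmf (\<lambda>j. j = i) (pmf_of_set {..<n}))"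
      unfolding poisson_uniform_snd by (simp add: map_pmf_comp)
    also have "\<dots> = map_pmf (\<lambda>\<omega>. \<omega> i) ?N"
      using that by (simp add: map_pmf_eq_uniform bernoulli_product_def Pi_pmf_component)
    finally show "map_pmf (\<lambda>\<omega>. \<omega> i) ?N = map_pmf (?Y i) ?M" ..
  qed simp_all
  have "map_pmf ?P ?M = map_pmf (\<lambda>x. nat \<lfloor>x\<rfloor>) (map_pmf (\<lambda>\<omega>. \<omega> 0) ?M)"
    by (simp add: map_pmf_comp)
  also have "\<dots> = poisson_pmf 1"
    unfolding poisson_uniform_fst by (simp add: map_pmf_comp)
  finally have lawP: "distr ?M (count_space UNIV) ?P = measure_pmf (poisson_pmf 1)"
    by (simp flip: map_pmf_rep_eq)
  have "prob_space.indep_vars ?M (\<lambda>_. count_space UNIV) (\<lambda>i \<omega>. \<omega> i) {0, 1}"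
    unfolding poisson_uniform_def by (rule indep_vars_Pi_pmf) simp
  then have "prob_space.indep_var ?M
      (PiM {0} (\<lambda>_. count_space UNIV)) (\<lambda>\<omega>. restrict (\<lambda>i. \<omega> i) {0})
      (PiM {1} (\<lambda>_. count_space UNIV)) (\<lambda>\<omega>. restrict (\<lambda>i. \<omega> i) {1})"
    by (rule prob_space.indep_var_restrict[OF measure_pmf.prob_space_axioms]) simp_all
  then have ind: "prob_space.indep_set ?M
      (sigma_sets (space ?M) {(\<lambda>\<omega>. restrict (\<lambda>i. \<omega> i) {0}) -` A \<inter> space ?M
          | A. A \<in> sets (PiM {0} (\<lambda>_. count_space UNIV))})
      (sigma_sets (space ?M) {(\<lambda>\<omega>. restrict (\<lambda>i. \<omega> i) {1}) -` A \<inter> space ?M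
          | A. A \<in> sets (PiM {1} (\<lambda>_. count_space UNIV))})"
    by (simp only: prob_space.indep_var_eq[OF measure_pmf.prob_space_axioms])
  have g: "(\<lambda>v. restrict (\<lambda>i. ?Y i v) {..<n}) \<in> measurable (PiM {1} (\<lambda>_. count_space UNIV)) (PiM {..<n} (\<lambda>_. borel))"
    by (intro measurable_restrict measurable_compose[OF measurable_component_singleton[of 1],
          where g = "\<lambda>x. of_bool (x = real _)"]) simp_all
  have f: "(\<lambda>v. nat \<lfloor>v 0\<rfloor>) \<in> measurable (PiM {0} (\<lambda>_. count_space UNIV)) (count_space UNIV)"
    by (intro measurable_compose[OF measurable_component_singleton[of 0], where g = "\<lambda>x. nat \<lfloor>x\<rfloor>"]) simp_all
  have "prob_space.indep_set ?M
      (sigma_sets (space ?M) {(\<lambda>\<omega>. nat \<lfloor>restrict (\<lambda>i. \<omega> i) {0} 0\<rfloor>) -` A \<inter> space ?M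
          | A. A \<in> sets (count_space UNIV)})
      (sigma_sets (space ?M) {(\<lambda>\<omega>. restrict (\<lambda>i. ?Y i (restrict (\<lambda>i. \<omega> i) {1})) {..<n}) -` A \<inter> space ?M
          | A. A \<in> sets (PiM {..<n} (\<lambda>_. borel))})"
    by (rule prob_space.indep_set_vimage_compose[OF measure_pmf.prob_space_axioms ind _ _ f g])
      (simp_all add: space_PiM)
  then have "prob_space.indep_set ?M
      (sigma_sets (space ?M) {?P -` A \<inter> space ?M | A. A \<in> sets (count_space UNIV)})
      (sigma_sets (space ?M) {(\<lambda>\<omega>. restrict (\<lambda>i. ?Y i \<omega>) {..<n}) -` A \<inter> space ?M
          | A. A \<in> sets (PiM {..<n} (\<lambda>_. borel))})"
    by simp
  then show ?thesis
    using indX law lawP unfolding thm5_setting_def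
    by (simp add: measure_pmf.prob_space_axioms)
qed

lemma nn_integral_bernoulli_product:
  assumes "0 < n"
  shows "(\<integral>\<^sup>+\<omega>. f (\<Sum>i<n. \<omega> i) \<partial>measure_pmf (bernoulli_product n))
       = (\<integral>\<^sup>+k. f (real k) \<partial>measure_pmf (binomial_pmf n (1 / real n)))"
proof -
  have "bernoulli_product n = map_pmf (\<lambda>h. of_bool \<circ> h) (Pi_pmf {..<n} False (\<lambda>_. bernoulli_pmf (1 / real n)))"
    unfolding bernoulli_product_def by (rule Pi_pmf_map) simp_all
  moreover have "binomial_pmf n (1 / real n)
      = map_pmf (\<lambda>h. card {i \<in> {..<n}. h i}) (Pi_pmf {..<n} False (\<lambda>_. bernoulli_pmf (1 / real n)))"
    using assms by (intro binomial_pmf_altdef') simp_all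
  moreover have "(\<Sum>i<n. of_bool (h i) :: real) = real (card {i \<in> {..<n}. h i})" for h
    by (simp add: of_bool_def sum.If_cases Int_def)
  ultimately show ?thesis
    by simp
qed

text \<open>Almost surely coordinate 1 is one of \<open>0, ..., n - 1\<close>, so exactly one
  indicator equals 1 and the product reduces to the Poisson count.\<close>

lemma nn_integral_poisson_uniform:
  assumes "0 < n"
  shows "(\<integral>\<^sup>+\<omega>. f (real (nat \<lfloor>\<omega> 0\<rfloor>) * (\<Sum>i<n. of_bool (\<omega> 1 = real i))) \<partial>measure_pmf (poisson_uniform n))
       = (\<integral>\<^sup>+k. f (real k) \<partial>measure_pmf (poisson_pmf 1))"
proof -
  have "(\<Sum>i<n. of_bool (\<omega> 1 = real i) :: real) = 1" if "\<omega> \<in> set_pmf (poisson_uniform n)" for \<omega>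
  proof -
    have "\<omega> 1 \<in> set_pmf (map_pmf (\<lambda>\<omega>. \<omega> 1) (poisson_uniform n))"
      using that by simp
    moreover have "set_pmf (pmf_of_set {..<n}) = {..<n}"
      using assms by (intro set_pmf_of_set) auto
    ultimately obtain j where "j < n" "\<omega> 1 = real j"
      unfolding poisson_uniform_snd by auto
    then show ?thesis
      by (simp add: of_bool_def sum.delta)
  qed
  then have "(\<integral>\<^sup>+\<omega>. f (real (nat \<lfloor>\<omega> 0\<rfloor>) * (\<Sum>i<n. of_bool (\<omega> 1 = real i))) \<partial>measure_pmf (poisson_uniform n))
      = (\<integral>\<^sup>+\<omega>. f (real (nat \<lfloor>\<omega> 0\<rfloor>)) \<partial>measure_pmf (poisson_uniform n))"
    by (intro nn_integral_cong_AE) (simp add: AE_measure_pmf_iff)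
  also have "\<dots> = (\<integral>\<^sup>+x. f (real (nat \<lfloor>x\<rfloor>)) \<partial>measure_pmf (map_pmf (\<lambda>\<omega>. \<omega> 0) (poisson_uniform n)))"
    by simp
  also have "\<dots> = (\<integral>\<^sup>+k. f (real k) \<partial>measure_pmf (poisson_pmf 1))"
    unfolding poisson_uniform_fst by simp
  finally show ?thesis .
qed

text \<open>Fatou's lemma for counting measure, applied to the convergent weights times
  \<open>f\<close>; finiteness of \<open>f k\<close> makes multiplication by it continuous.\<close>

lemma nn_integral_poisson_le_liminf_binomial:
  fixes f :: "nat \<Rightarrow> ennreal"
  assumes "\<And>k. f k < \<top>"
  shows "(\<integral>\<^sup>+k. f k \<partial>measure_pmf (poisson_pmf 1))
      \<le> liminf (\<lambda>n. \<integral>\<^sup>+k. f k \<partial>measure_pmf (binomial_pmf n (1 / real n)))"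
proof -
  have "(\<lambda>n. ennreal (pmf (binomial_pmf n (1 / real n)) k) * f k)
      \<longlonglongrightarrow> ennreal (pmf (poisson_pmf 1) k) * f k" for k
    using ennreal_tendsto_cmult[OF assms tendsto_ennrealI[OF pmf_binomial_tendsto_poisson], of k k]
    by (simp only: mult.commute)
  then have "(\<integral>\<^sup>+k. f k \<partial>measure_pmf (poisson_pmf 1))
      = (\<integral>\<^sup>+k. liminf (\<lambda>n. ennreal (pmf (binomial_pmf n (1 / real n)) k) * f k) \<partial>count_space UNIV)"
    unfolding nn_integral_measure_pmf by (intro nn_integral_cong lim_imp_Liminf[symmetric] sequentially_bot)
  also have "\<dots> \<le> liminf (\<lambda>n. \<integral>\<^sup>+k. f k \<partial>measure_pmf (binomial_pmf n (1 / real n)))"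
    unfolding nn_integral_measure_pmf by (rule nn_integral_liminf) simp
  finally show ?thesis .
qed

text \<open>If \<open>(1 - \<epsilon>) c\<close> is positive, it lies strictly below
  \<open>c\<close> and hence below the liminf of the binomial means, so every large \<open>n\<close>
  works; otherwise \<open>ennreal\<close> sends it to 0.\<close>

lemma poisson_bound_asymptotically_sharp:
  fixes \<phi> :: "real \<Rightarrow> real"
  assumes nn: "\<And>x. 0 \<le> \<phi> x" and int: "integrable (measure_pmf (poisson_pmf 1)) (\<lambda>k. \<phi> (real k))"
    and \<epsilon>: "0 < \<epsilon>"
  shows "\<exists>n (M :: (nat \<Rightarrow> real) measure) Y P (N :: (nat \<Rightarrow> real) measure) X.
         thm5_setting n M Y P N X \<and>
         ennreal (1 - \<epsilon>) * (\<integral>\<^sup>+\<omega>. ennreal (\<phi> (real (P \<omega>) * (\<Sum>i<n. Y i \<omega>))) \<partial>M)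
           \<le> (\<integral>\<^sup>+\<omega>. ennreal (\<phi> (\<Sum>i<n. X i \<omega>)) \<partial>N)"
proof -
  let ?B = "\<lambda>n. \<integral>\<^sup>+k. ennreal (\<phi> (real k)) \<partial>measure_pmf (binomial_pmf n (1 / real n))"
  define c where "c = (\<integral>k. \<phi> (real k) \<partial>measure_pmf (poisson_pmf 1))"
  have c: "(\<integral>\<^sup>+k. ennreal (\<phi> (real k)) \<partial>measure_pmf (poisson_pmf 1)) = ennreal c" and "0 \<le> c"
    unfolding c_def using int nn by (simp_all add: nn_integral_eq_integral integral_nonneg_AE)
  have "\<forall>\<^sub>F n in sequentially. ennreal ((1 - \<epsilon>) * c) \<le> ?B n"
  proof (cases "(1 - \<epsilon>) * c \<le> 0")
    case True
    then show ?thesis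
      by (simp add: ennreal_neg)
  next
    case False
    with \<open>0 \<le> c\<close> \<epsilon> have "(1 - \<epsilon>) * c < c"
      by (cases "c = 0") (auto simp: algebra_simps)
    with False have "ennreal ((1 - \<epsilon>) * c) < ennreal c"
      by (intro ennreal_lessI) auto
    also have "\<dots> \<le> liminf ?B"
      using nn_integral_poisson_le_liminf_binomial[of "\<lambda>k. ennreal (\<phi> (real k))"] c by simp
    finally show ?thesis
      by (auto dest!: less_LiminfD elim: eventually_mono)
  qed
  \<comment> \<open>Positive \<open>n\<close> keeps the index set \<open>{..<n}\<close> of the
    example nonempty.\<close>
  then have "\<forall>\<^sub>F n in sequentially. 0 < n \<and> ennreal ((1 - \<epsilon>) * c) \<le> ?B n"
    by (intro eventually_conj eventually_gt_at_top)
  then obtain n where n: "0 < n" "ennreal ((1 - \<epsilon>) * c) \<le> ?B n"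
    by (metis (no_types, lifting) eventually_sequentially order.refl)
  show ?thesis
  proof (intro exI conjI)
    show "thm5_setting n (measure_pmf (poisson_uniform n)) (\<lambda>i \<omega>. of_bool (\<omega> 1 = real i)) (\<lambda>\<omega>. nat \<lfloor>\<omega> 0\<rfloor>)
       (measure_pmf (bernoulli_product n)) (\<lambda>i \<omega>. \<omega> i)"
      using n(1) by (rule thm5_setting_bernoulli)
    have "ennreal (1 - \<epsilon>) * ennreal c = ennreal ((1 - \<epsilon>) * c)"
      using \<open>0 \<le> c\<close> by (simp add: ennreal_mult'')
    then show "ennreal (1 - \<epsilon>) * (\<integral>\<^sup>+\<omega>. ennreal (\<phi> (real (nat \<lfloor>\<omega> 0\<rfloor>) * (\<Sum>i<n. of_bool (\<omega> 1 = real i))))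
          \<partial>measure_pmf (poisson_uniform n))
        \<le> (\<integral>\<^sup>+\<omega>. ennreal (\<phi> (\<Sum>i<n. \<omega> i)) \<partial>measure_pmf (bernoulli_product n))"
      using n nn_integral_bernoulli_product[OF n(1), of "\<lambda>x. ennreal (\<phi> x)"]
        nn_integral_poisson_uniform[OF n(1), of "\<lambda>x. ennreal (\<phi> x)"] c
      by simp
  qed
qed

theorem theorem5:
  shows
  "(\<forall>(n::nat) (M::'a measure) Y P (N::'b measure) X.
      thm5_setting n M Y P N X \<longrightarrow>
      convex_order_le N (\<lambda>\<omega>. \<Sum>i<n. X i \<omega>) M (\<lambda>\<omega>. real (P \<omega>) * (\<Sum>i<n. Y i \<omega>)))
   \<and>
   (\<forall>(\<phi>::real \<Rightarrow> real) (\<epsilon>::real).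
      \<phi> \<in> borel_measurable borel \<longrightarrow> (\<forall>x. 0 \<le> \<phi> x) \<longrightarrow>
      integrable (measure_pmf (poisson_pmf 1)) (\<lambda>k. \<phi> (real k)) \<longrightarrow> 0 < \<epsilon> \<longrightarrow>
      (\<exists>(n::nat) (M::(nat \<Rightarrow> real) measure) Y P (N::(nat \<Rightarrow> real) measure) X.
         thm5_setting n M Y P N X \<and>
         (\<integral>\<^sup>+\<omega>. ennreal (\<phi> (\<Sum>i<n. X i \<omega>)) \<partial>N) \<ge>
           ennreal (1 - \<epsilon>) * (\<integral>\<^sup>+\<omega>. ennreal (\<phi> (real (P \<omega>) * (\<Sum>i<n. Y i \<omega>))) \<partial>M)))"
  using thm5_setting_convex_order_le poisson_bound_asymptotically_sharp by blast

end
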